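(* There exists a basis (of some Banach space) that is $\omega$-greedy for some structured weight $\omega$ on subsets of $\mathbb{N}$ but is not $\varsigma$-almost greedy for any weight sequence $\varsigma=(s_n)_{n=1}^\infty\in(0,\infty)^{\mathbb{N}}$.
   Context: Banach spaces are over $\mathbb{K}=\mathbb{R}$ or $\mathbb{C}$. A basis of a Banach space $\mathbb{X}$ means a semi-normalized Schauder basis $\mathcal{B}=(e_n)_{n=1}^\infty$, i.e. $0<\inf_n\|e_n\|\le\sup_n\|e_n\|<\infty$, with biorthogonal functionals $(e_n^* )_{n=1}^\infty\subset\mathbb{X}^*$. $\mathbb{N}^{<\infty}$ is the set of finite subsets of $\mathbb{N}$. $P_A(x)=\sum_{n\in A}e_n^*(x)e_n$. A structured weight is a function $\omega:\mathcal{P}(\mathbb{N})\to[0,\infty]$, with value at $A$ written $w(A)$ and $w_n:=w(\{n\})$, such that: (a) $w(\emptyset)=0$; (b) $w(A)<\infty$ if $|A|<\infty$; (c) $w(A)\in(0,\infty]$ for each nonempty $A\subset\mathbb{N}$; (d) $w(A)\to0$ as $\sum_{n\in A}w_n\to0$ (for every $\eta>0$ there is $\theta>0$ such that $\sum_{n\in A}w_n<\theta$ implies $w(A)<\eta$); (e) $w(A)\to\infty$ as $\sum_{n\in A}w_n\to\infty$ (for every $M$ there is $K$ such that $\sum_{n\in A}w_n>K$ implies $w(A)>M$); (f) there are arbitrarily large $N\in\mathbb{N}$ for each of which there exists $\varepsilon>0$ with $w(\{N,n\})-w_n>\varepsilon$ for all $n\in\mathbb{N}$, $n\ne N$. Greedy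 sets: for $x\in\mathbb{X}$, $m\in\mathbb{N}$, a greedy set of order $m$ of $x$ is a set $\Lambda_m(x)\subset\mathbb{N}$ with $|\Lambda_m(x)|=m$ and $\min_{n\in\Lambda_m(x)}|e_n^*(x)|\ge\max_{n\notin\Lambda_m(x)}|e_n^*(x)|$; the corresponding greedy sum is $G_m(x)=\sum_{n\in\Lambda_m(x)}e_n^*(x)e_n$. $\mathcal{B}$ is $\omega$-greedy if there is $C\ge1$ such that for all $x\in\mathbb{X}$, $m\in\mathbb{N}$ and all greedy sets $\Lambda_m(x)$, $\|x-G_m(x)\|\le C\sigma^\omega_{\Lambda_m(x)}(x)$, where for $B\subset\mathbb{N}$ $$\sigma^\omega_B(x)=\inf\Big\{\Big\|x-\sum_{n\in A}a_ne_n\Big\|: A\in\mathbb{N}^{<\infty},\ w(A\setminus B)\le w(B\setminus A),\ a_n\in\mathbb{K}\Big\}.$$ For a weight sequence $\varsigma=(s_n)_{n=1}^\infty\in(0,\infty)^{\mathbb{N}}$ put $s(A)=\sum_{n\in A}s_n$. $\mathcal{B}$ is $\varsigma$-almost greedy if there is $C\ge1$ such that $\|x-G_m(x)\|\le C\widetilde\sigma^\varsigma_{s(\Lambda_m(x))}(x)$ for all $x\in\mathbb{X}$, $m\in\mathbb{N}$ and all greedy sets $\Lambda_m(x)$, where for $\alpha\ge0$, $\widetilde\sigma^\varsigma_\alpha(x)=\inf\{\|x-P_A(x)\|: |A|<\infty,\ s(A)\le\alpha\}$. *)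

theory Defs
  imports "HOL-Analysis.Analysis" "HOL-Library.Function_Algebras"
begin

text \<open>
  A Banach space over the field \<open>'k\<close> is a linear subspace \<open>V\<close> of an ambient
  \<open>'k\<close>-vector space together with a complete norm \<open>nrm\<close> on \<open>V\<close>. The values of \<open>nrm\<close>
  outside \<open>V\<close> are irrelevant. A carrier set is used since one cannot quantify
  existentially over types, and an explicit scalar multiplication since the
  library class of Banach spaces only covers real scalars.
\<close>

definition banach_space ::
  "('k::real_normed_field \<Rightarrow> 'v::ab_group_add \<Rightarrow> 'v) \<Rightarrow> 'v set \<Rightarrow> ('v \<Rightarrow> real) \<Rightarrow> bool"
  where "banach_space smul V nrm \<longleftrightarrow>
    vector_space smul \<and> module.subspace smul V \<and>
    (\<forall>x\<in>V. 0 \<le> nrm x) \<and>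
    (\<forall>x\<in>V. nrm x = 0 \<longleftrightarrow> x = 0) \<and>
    (\<forall>x\<in>V. \<forall>y\<in>V. nrm (x + y) \<le> nrm x + nrm y) \<and>
    (\<forall>c. \<forall>x\<in>V. nrm (smul c x) = norm c * nrm x) \<and>
    (\<forall>f. (\<forall>n. f n \<in> V) \<and> (\<forall>\<epsilon>>0. \<exists>M. \<forall>m\<ge>M. \<forall>n\<ge>M. nrm (f m - f n) < \<epsilon>) \<longrightarrow>
      (\<exists>x\<in>V. (\<lambda>n. nrm (f n - x)) \<longlonglongrightarrow> 0))"

definition basis_expansion ::
  "('k::real_normed_field \<Rightarrow> 'v::ab_group_add \<Rightarrow> 'v) \<Rightarrow> ('v \<Rightarrow> real) \<Rightarrow> (nat \<Rightarrow> 'v) \<Rightarrow> 'v \<Rightarrow>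
    (nat \<Rightarrow> 'k) \<Rightarrow> bool"
  where "basis_expansion smul nrm e x a \<longleftrightarrow> (\<lambda>N. nrm (x - (\<Sum>n<N. smul (a n) (e n)))) \<longlonglongrightarrow> 0"

definition schauder_basis ::
  "('k::real_normed_field \<Rightarrow> 'v::ab_group_add \<Rightarrow> 'v) \<Rightarrow> 'v set \<Rightarrow> ('v \<Rightarrow> real) \<Rightarrow>
    (nat \<Rightarrow> 'v) \<Rightarrow> bool"
  where "schauder_basis smul V nrm e \<longleftrightarrow>
    (\<forall>n. e n \<in> V) \<and> (\<forall>x\<in>V. \<exists>!a. basis_expansion smul nrm e x a)"

definition semi_normalized :: "('v \<Rightarrow> real) \<Rightarrow> (nat \<Rightarrow> 'v) \<Rightarrow> bool"
  where "semi_normalized nrm e \<longleftrightarrow> (\<exists>c>0. \<exists>C. \<forall>n. c \<le> nrm (e n) \<and> nrm (e n) \<le> C)"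

text \<open>
  The value at \<open>x\<close> of the \<open>n\<close>-th biorthogonal functional of a Schauder basis of a Banach
  space; these functionals are automatically linear and continuous.
\<close>

definition coord ::
  "('k::real_normed_field \<Rightarrow> 'v::ab_group_add \<Rightarrow> 'v) \<Rightarrow> ('v \<Rightarrow> real) \<Rightarrow> (nat \<Rightarrow> 'v) \<Rightarrow>
    nat \<Rightarrow> 'v \<Rightarrow> 'k"
  where "coord smul nrm e n x = (THE a. basis_expansion smul nrm e x a) n"

definition partial_proj ::
  "('k::real_normed_field \<Rightarrow> 'v::ab_group_add \<Rightarrow> 'v) \<Rightarrow> ('v \<Rightarrow> real) \<Rightarrow> (nat \<Rightarrow> 'v) \<Rightarrow>
    nat set \<Rightarrow> 'v \<Rightarrow> 'v"
  where "partial_proj smul nrm e A x = (\<Sum>n\<in>A. smul (coord smul nrm e n x) (e n))"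

definition greedy_set ::
  "('k::real_normed_field \<Rightarrow> 'v::ab_group_add \<Rightarrow> 'v) \<Rightarrow> ('v \<Rightarrow> real) \<Rightarrow> (nat \<Rightarrow> 'v) \<Rightarrow>
    'v \<Rightarrow> nat \<Rightarrow> nat set \<Rightarrow> bool"
  where "greedy_set smul nrm e x m \<Lambda> \<longleftrightarrow>
    finite \<Lambda> \<and> card \<Lambda> = m \<and>
    (\<forall>i\<in>\<Lambda>. \<forall>j. j \<notin> \<Lambda> \<longrightarrow> norm (coord smul nrm e i x) \<ge> norm (coord smul nrm e j x))"

definition structured_weight :: "(nat set \<Rightarrow> ennreal) \<Rightarrow> bool"
  where "structured_weight w \<longleftrightarrow>
    w {} = 0 \<and>
    (\<forall>A. finite A \<longrightarrow> w A < \<infinity>) \<and>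
    (\<forall>A. A \<noteq> {} \<longrightarrow> 0 < w A) \<and>
    (\<forall>\<eta>::real. 0 < \<eta> \<longrightarrow>
      (\<exists>\<theta>::real. 0 < \<theta> \<and> (\<forall>A. (\<Sum>\<^sub>\<infinity>n\<in>A. w {n}) < ennreal \<theta> \<longrightarrow> w A < ennreal \<eta>))) \<and>
    (\<forall>M::real. 0 < M \<longrightarrow>
      (\<exists>K::real. 0 < K \<and> (\<forall>A. (\<Sum>\<^sub>\<infinity>n\<in>A. w {n}) > ennreal K \<longrightarrow> w A > ennreal M))) \<and>
    (\<forall>N0. \<exists>N\<ge>N0. \<exists>\<epsilon>::real. 0 < \<epsilon> \<and> (\<forall>n. n \<noteq> N \<longrightarrow> w {N, n} - w {n} > ennreal \<epsilon>))"

definition sigma_omega ::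
  "('k::real_normed_field \<Rightarrow> 'v::ab_group_add \<Rightarrow> 'v) \<Rightarrow> ('v \<Rightarrow> real) \<Rightarrow> (nat \<Rightarrow> 'v) \<Rightarrow>
    (nat set \<Rightarrow> ennreal) \<Rightarrow> nat set \<Rightarrow> 'v \<Rightarrow> real"
  where "sigma_omega smul nrm e w B x =
    Inf {nrm (x - (\<Sum>n\<in>A. smul (a n) (e n))) | A a. finite A \<and> w (A - B) \<le> w (B - A)}"

text \<open>The order of a greedy set ranges over the positive integers.\<close>

definition omega_greedy ::
  "('k::real_normed_field \<Rightarrow> 'v::ab_group_add \<Rightarrow> 'v) \<Rightarrow> 'v set \<Rightarrow> ('v \<Rightarrow> real) \<Rightarrow>
    (nat \<Rightarrow> 'v) \<Rightarrow> (nat set \<Rightarrow> ennreal) \<Rightarrow> bool"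
  where "omega_greedy smul V nrm e w \<longleftrightarrow>
    (\<exists>C\<ge>1. \<forall>x\<in>V. \<forall>m\<ge>1. \<forall>\<Lambda>. greedy_set smul nrm e x m \<Lambda> \<longrightarrow>
      nrm (x - partial_proj smul nrm e \<Lambda> x) \<le> C * sigma_omega smul nrm e w \<Lambda> x)"

definition sigma_tilde ::
  "('k::real_normed_field \<Rightarrow> 'v::ab_group_add \<Rightarrow> 'v) \<Rightarrow> ('v \<Rightarrow> real) \<Rightarrow> (nat \<Rightarrow> 'v) \<Rightarrow>
    (nat \<Rightarrow> real) \<Rightarrow> real \<Rightarrow> 'v \<Rightarrow> real"
  where "sigma_tilde smul nrm e s \<alpha> x =
    Inf {nrm (x - partial_proj smul nrm e A x) | A. finite A \<and> sum s A \<le> \<alpha>}"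

definition almost_greedy ::
  "('k::real_normed_field \<Rightarrow> 'v::ab_group_add \<Rightarrow> 'v) \<Rightarrow> 'v set \<Rightarrow> ('v \<Rightarrow> real) \<Rightarrow>
    (nat \<Rightarrow> 'v) \<Rightarrow> (nat \<Rightarrow> real) \<Rightarrow> bool"
  where "almost_greedy smul V nrm e s \<longleftrightarrow>
    (\<exists>C\<ge>1. \<forall>x\<in>V. \<forall>m\<ge>1. \<forall>\<Lambda>. greedy_set smul nrm e x m \<Lambda> \<longrightarrow>
      nrm (x - partial_proj smul nrm e \<Lambda> x) \<le> C * sigma_tilde smul nrm e s (sum s \<Lambda>) x)"

end

theory Submission
  imports Defs
begin

text \<open>
  Take the canonical basis of \<open>\<ell>\<^sub>1 \<oplus> \<ell>\<^sub>2\<close>, with \<open>\<ell>\<^sub>1\<close> living on the odd and \<open>\<ell>\<^sub>2\<close> on the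
  even indices, and \<open>w(A) = \<parallel>1\<^sub>A\<parallel> = |A \<inter> Odd| + |A \<inter> Even|\<^sup>1\<^sup>/\<^sup>2\<close>. The basis is 1-unconditional and
  trivially democratic with respect to \<open>w\<close>, hence \<open>w\<close>-greedy. If it were almost greedy
  for an additive weight \<open>s\<close> with constant \<open>C\<close>, then \<open>s(A) \<le> s(B)\<close> would imply
  \<open>\<parallel>1\<^sub>A\<parallel> \<le> C \<parallel>1\<^sub>B\<parallel>\<close> for disjoint \<open>A\<close> and \<open>B\<close>. Comparing singletons with large
  sets, \<open>s\<close> is bounded on the odd indices and at least linear in the size of sets of even
  indices. So a set of \<open>n\<close> even indices has larger weight than one with about
  \<open>C\<surd>n\<close> odd indices, although the latter has the larger norm.
\<close>

section \<open>The space\<close>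

definition smult_seq :: "'k::real_normed_field \<Rightarrow> (nat \<Rightarrow> 'k) \<Rightarrow> nat \<Rightarrow> 'k"
  where "smult_seq c f = (\<lambda>n. c * f n)"

definition unit_seq :: "nat \<Rightarrow> nat \<Rightarrow> 'k::real_normed_field"
  where "unit_seq n = (\<lambda>k. if k = n then 1 else 0)"

definition restrict_seq :: "nat set \<Rightarrow> (nat \<Rightarrow> 'k::real_normed_field) \<Rightarrow> nat \<Rightarrow> 'k"
  where "restrict_seq A f = (\<lambda>k. if k \<in> A then f k else 0)"

text \<open>The norm of \<ell>_1 \<oplus> \<ell>_2 applied to the first \<open>N\<close>
  coordinates. Only finite sums occur, so no summability question arises; the space and its norm are
  then obtained from boundedness and the supremum over \<open>N\<close>.\<close>

definition initial_norm :: "nat \<Rightarrow> (nat \<Rightarrow> 'k::real_normed_field) \<Rightarrow> real"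
  where "initial_norm N f = (\<Sum>n<N. if odd n then norm (f n) else 0) +
    L2_set (\<lambda>n. if even n then norm (f n) else 0) {..<N}"

definition mixed_space :: "(nat \<Rightarrow> 'k::real_normed_field) set"
  where "mixed_space = {f. bdd_above (range (\<lambda>N. initial_norm N f))}"

text \<open>The supremum is taken in the reals, hence it is meaningful only for sequences in
  \<open>mixed_space\<close>, where the range is bounded above.\<close>

definition mixed_norm :: "(nat \<Rightarrow> 'k::real_normed_field) \<Rightarrow> real"
  where "mixed_norm f = (SUP N. initial_norm N f)"

lemma initial_norm_nonneg: "0 \<le> initial_norm N f"
  unfolding initial_norm_def by (intro add_nonneg_nonneg sum_nonneg L2_set_nonneg) auto

lemma initial_norm_dominated:
  assumes "\<And>n. n < N \<Longrightarrow> norm (f n) \<le> norm (g n)"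
  shows "initial_norm N f \<le> initial_norm N g"
  unfolding initial_norm_def using assms
  by (intro add_mono sum_mono L2_set_mono) auto

lemma initial_norm_triangle: "initial_norm N (f + g) \<le> initial_norm N f + initial_norm N g"
proof -
  have "(\<Sum>n<N. if odd n then norm ((f + g) n) else 0) \<le>
      (\<Sum>n<N. if odd n then norm (f n) else 0) + (\<Sum>n<N. if odd n then norm (g n) else 0)"
    unfolding sum.distrib[symmetric] by (intro sum_mono) (auto simp: norm_triangle_ineq)
  moreover have "L2_set (\<lambda>n. if even n then norm ((f + g) n) else 0) {..<N} \<le>
      L2_set (\<lambda>n. (if even n then norm (f n) else 0) + (if even n then norm (g n) else 0)) {..<N}"
    by (intro L2_set_mono) (auto simp: norm_triangle_ineq)
  moreover note L2_set_triangle_ineq[of "\<lambda>n. if even n then norm (f n) else 0"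
      "\<lambda>n. if even n then norm (g n) else 0" "{..<N}"]
  ultimately show ?thesis
    unfolding initial_norm_def by linarith
qed

lemma initial_norm_smult: "initial_norm N (smult_seq c f) = norm c * initial_norm N f"
proof -
  have "(\<Sum>n<N. if odd n then norm (smult_seq c f n) else 0) =
      norm c * (\<Sum>n<N. if odd n then norm (f n) else 0)"
    unfolding sum_distrib_left by (intro sum.cong) (auto simp: smult_seq_def norm_mult)
  moreover have "L2_set (\<lambda>n. if even n then norm (smult_seq c f n) else 0) {..<N} =
      norm c * L2_set (\<lambda>n. if even n then norm (f n) else 0) {..<N}"
    unfolding L2_set_right_distrib[OF norm_ge_zero]
    by (intro L2_set_cong) (auto simp: smult_seq_def norm_mult)
  ultimately show ?thesis
    unfolding initial_norm_def by (simp add: algebra_simps)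
qed

lemma norm_le_initial_norm:
  assumes "n < N"
  shows "norm (f n) \<le> initial_norm N f"
proof (cases "odd n")
  case True
  have "norm (f n) \<le> (\<Sum>n<N. if odd n then norm (f n) else 0)"
    using member_le_sum[of n "{..<N}" "\<lambda>n. if odd n then norm (f n) else 0"] True assms by simp
  then show ?thesis
    unfolding initial_norm_def by (simp add: add_increasing2 L2_set_nonneg)
next
  case False
  have "norm (f n) \<le> L2_set (\<lambda>n. if even n then norm (f n) else 0) {..<N}"
    using member_le_L2_set[of "{..<N}" n "\<lambda>n. if even n then norm (f n) else 0"] False assms by simp
  then show ?thesis
    unfolding initial_norm_def by (intro add_increasing) (auto intro: sum_nonneg)
qed

text \<open>Coordinatewise convergence suffices because each truncated norm depends continuously on
  finitely many coordinates. This drives the completeness proof.\<close>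

lemma initial_norm_tendsto:
  assumes "\<And>n. (\<lambda>k. f k n) \<longlonglongrightarrow> g n"
  shows "(\<lambda>k. initial_norm N (f k)) \<longlonglongrightarrow> initial_norm N g"
proof -
  have odd: "(\<lambda>k. if odd n then norm (f k n) else 0) \<longlonglongrightarrow> (if odd n then norm (g n) else 0)"
    and even: "(\<lambda>k. if even n then norm (f k n) else 0) \<longlonglongrightarrow> (if even n then norm (g n) else 0)"
    for n
    by (auto intro: tendsto_norm assms)
  show ?thesis
    unfolding initial_norm_def L2_set_def
    by (intro tendsto_add tendsto_sum tendsto_real_sqrt tendsto_power odd even)
qed

section \<open>The supremum norm and completeness\<close>

lemma mixed_spaceI: "(\<And>N. initial_norm N f \<le> K) \<Longrightarrow> f \<in> mixed_space"
  unfolding mixed_space_def bdd_above_def by auto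

lemma initial_norm_le_mixed_norm: "f \<in> mixed_space \<Longrightarrow> initial_norm N f \<le> mixed_norm f"
  unfolding mixed_space_def mixed_norm_def by (auto intro: cSUP_upper)

lemma mixed_norm_le: "(\<And>N. initial_norm N f \<le> K) \<Longrightarrow> mixed_norm f \<le> K"
  unfolding mixed_norm_def by (auto intro: cSUP_least)

lemma mixed_norm_nonneg: "f \<in> mixed_space \<Longrightarrow> 0 \<le> mixed_norm f"
  using initial_norm_le_mixed_norm initial_norm_nonneg order_trans by blast

lemma norm_le_mixed_norm: "f \<in> mixed_space \<Longrightarrow> norm (f n) \<le> mixed_norm f"
  using initial_norm_le_mixed_norm norm_le_initial_norm[of n "Suc n"] order_trans by blast

text \<open>The lattice property of the norm. It makes the basis 1-unconditional: restricting a
  sequence to any index set does not increase its norm.\<close>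

lemma mixed_space_dominated:
  assumes "g \<in> mixed_space" "\<And>n. norm (f n) \<le> norm (g n)"
  shows "f \<in> mixed_space" "mixed_norm f \<le> mixed_norm g"
proof -
  have "initial_norm N f \<le> mixed_norm g" for N
    using initial_norm_dominated[of N f g] initial_norm_le_mixed_norm[OF assms(1), of N] assms(2)
    by fastforce
  then show "f \<in> mixed_space" "mixed_norm f \<le> mixed_norm g"
    by (auto intro: mixed_spaceI mixed_norm_le)
qed

lemma mixed_space_add:
  assumes "f \<in> mixed_space" "g \<in> mixed_space"
  shows "f + g \<in> mixed_space" "mixed_norm (f + g) \<le> mixed_norm f + mixed_norm g"
proof -
  have "initial_norm N (f + g) \<le> mixed_norm f + mixed_norm g" for N
    using initial_norm_triangle[of N f g] initial_norm_le_mixed_norm[OF assms(1), of N]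
      initial_norm_le_mixed_norm[OF assms(2), of N] by linarith
  then show "f + g \<in> mixed_space" "mixed_norm (f + g) \<le> mixed_norm f + mixed_norm g"
    by (auto intro: mixed_spaceI mixed_norm_le)
qed

lemma mixed_space_smult:
  assumes "f \<in> mixed_space"
  shows "smult_seq c f \<in> mixed_space"
  using initial_norm_le_mixed_norm[OF assms]
  by (intro mixed_spaceI[where K = "norm c * mixed_norm f"])
    (simp add: initial_norm_smult mult_left_mono)

lemma mixed_norm_smult:
  assumes "f \<in> mixed_space"
  shows "mixed_norm (smult_seq c f) = norm c * mixed_norm f"
proof (rule antisym)
  show "mixed_norm (smult_seq c f) \<le> norm c * mixed_norm f"
    using initial_norm_le_mixed_norm[OF assms]
    by (intro mixed_norm_le) (simp add: initial_norm_smult mult_left_mono)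
  show "norm c * mixed_norm f \<le> mixed_norm (smult_seq c f)"
  proof (cases "c = 0")
    case True
    then show ?thesis
      using mixed_norm_nonneg[OF mixed_space_smult[OF assms]] by simp
  next
    case False
    have "mixed_norm f \<le> mixed_norm (smult_seq c f) / norm c"
      using initial_norm_le_mixed_norm[OF mixed_space_smult[OF assms, of c]] False
      by (intro mixed_norm_le) (simp add: initial_norm_smult field_simps)
    then show ?thesis
      using False by (simp add: field_simps)
  qed
qed

lemma initial_norm_zero: "initial_norm N 0 = 0"
  by (simp add: initial_norm_def L2_set_def cong: if_cong)

lemma zero_in_mixed_space: "0 \<in> mixed_space"
  by (rule mixed_spaceI[where K = 0]) (simp add: initial_norm_zero)

lemma mixed_space_diff:
  assumes "f \<in> mixed_space" "g \<in> mixed_space"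
  shows "f - g \<in> mixed_space"
proof -
  have eq: "f - g = f + smult_seq (-1) g"
    by (auto simp: smult_seq_def)
  show ?thesis
    unfolding eq using assms by (intro mixed_space_add mixed_space_smult)
qed

lemma mixed_norm_eq_0_iff:
  assumes "f \<in> mixed_space"
  shows "mixed_norm f = 0 \<longleftrightarrow> f = 0"
proof
  assume "mixed_norm f = 0"
  then show "f = 0"
    using norm_le_mixed_norm[OF assms] by (auto simp: fun_eq_iff)
next
  assume "f = 0"
  then show "mixed_norm f = 0"
    by (simp add: mixed_norm_def initial_norm_zero)
qed

lemma vector_space_smult: "vector_space (smult_seq :: 'k::real_normed_field \<Rightarrow> _)"
  by unfold_locales (auto simp: smult_seq_def algebra_simps)

text \<open>Coordinates are dominated by the norm, so a Cauchy sequence has a coordinatewise limit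
  in the complete field. The Cauchy estimate then passes to this limit.\<close>

lemma mixed_space_complete:
  fixes f :: "nat \<Rightarrow> nat \<Rightarrow> 'k::{real_normed_field, banach}"
  assumes mem: "\<And>n. f n \<in> mixed_space"
    and cauchy: "\<And>\<epsilon>. 0 < \<epsilon> \<Longrightarrow> \<exists>M. \<forall>m\<ge>M. \<forall>n\<ge>M. mixed_norm (f m - f n) < \<epsilon>"
  shows "\<exists>x\<in>mixed_space. (\<lambda>n. mixed_norm (f n - x)) \<longlonglongrightarrow> 0"
proof -
  have "Cauchy (\<lambda>n. f n k)" for k
  proof (rule CauchyI)
    fix \<epsilon> :: real assume "0 < \<epsilon>"
    then obtain M where "\<forall>m\<ge>M. \<forall>n\<ge>M. mixed_norm (f m - f n) < \<epsilon>"
      using cauchy by blast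
    moreover have "norm (f m k - f n k) \<le> mixed_norm (f m - f n)" for m n
      using norm_le_mixed_norm[OF mixed_space_diff[OF mem[of m] mem[of n]], of k] by simp
    ultimately show "\<exists>M. \<forall>m\<ge>M. \<forall>n\<ge>M. norm (f m k - f n k) < \<epsilon>"
      by (meson le_less_trans)
  qed
  then have "\<exists>y. (\<lambda>n. f n k) \<longlonglongrightarrow> y" for k
    using Cauchy_convergent_iff unfolding convergent_def by blast
  then obtain x where x: "\<And>k. (\<lambda>n. f n k) \<longlonglongrightarrow> x k"
    by metis
  \<comment> \<open>With \<open>N\<close> fixed, let \<open>n\<close> tend to infinity in the Cauchy
    estimate. The threshold \<open>M\<close> does not depend on \<open>N\<close>, and membership of
    \<open>x\<close> in the space is not yet presupposed.\<close>
  have close: "\<exists>M. \<forall>m\<ge>M. \<forall>N. initial_norm N (f m - x) \<le> \<epsilon>" if pos: "0 < \<epsilon>" for \<epsilon>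
  proof -
    obtain M where M: "\<forall>m\<ge>M. \<forall>n\<ge>M. mixed_norm (f m - f n) < \<epsilon>"
      using cauchy[OF pos] by blast
    have "initial_norm N (f m - x) \<le> \<epsilon>" if "m \<ge> M" for m N
    proof (rule LIMSEQ_le_const2)
      show "(\<lambda>n. initial_norm N (f m - f n)) \<longlonglongrightarrow> initial_norm N (f m - x)"
        by (rule initial_norm_tendsto) (auto intro: tendsto_diff x)
      have "initial_norm N (f m - f n) \<le> \<epsilon>" if "n \<ge> M" for n
        using M \<open>m \<ge> M\<close> that
          initial_norm_le_mixed_norm[OF mixed_space_diff[OF mem[of m] mem[of n]], of N] by force
      then show "\<exists>K. \<forall>n\<ge>K. initial_norm N (f m - f n) \<le> \<epsilon>"
        by blast
    qed
    then show ?thesis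
      by blast
  qed
  \<comment> \<open>Bounded truncated norms put \<open>f m - x\<close> into the space, and
    \<open>x\<close> is recovered as \<open>f m - (f m - x)\<close>.\<close>
  have diff_mem: "\<exists>m. f m - x \<in> mixed_space"
    using close[of 1] mixed_spaceI by (metis order_refl zero_less_one)
  then obtain m where "f m - x \<in> mixed_space"
    by blast
  from mixed_space_diff[OF mem[of m] this] have x_mem: "x \<in> mixed_space"
    by simp
  moreover have "(\<lambda>n. mixed_norm (f n - x)) \<longlonglongrightarrow> 0"
  proof (rule LIMSEQ_I)
    fix r :: real assume "0 < r"
    then obtain M where "\<forall>m\<ge>M. \<forall>N. initial_norm N (f m - x) \<le> r / 2"
      using close[of "r / 2"] by auto
    then have "mixed_norm (f n - x) \<le> r / 2" if "n \<ge> M" for n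
      using that by (intro mixed_norm_le) blast
    moreover have "0 \<le> mixed_norm (f n - x)" for n
      by (intro mixed_norm_nonneg mixed_space_diff mem x_mem)
    ultimately show "\<exists>M. \<forall>n\<ge>M. norm (mixed_norm (f n - x) - 0) < r"
      using \<open>0 < r\<close> by (intro exI[of _ M]) force
  qed
  ultimately show ?thesis
    by blast
qed

lemma banach_space_mixed:
  "banach_space smult_seq (mixed_space :: (nat \<Rightarrow> 'k::{real_normed_field, banach}) set) mixed_norm"
proof -
  interpret vector_space "smult_seq :: 'k \<Rightarrow> _"
    by (rule vector_space_smult)
  have "subspace (mixed_space :: (nat \<Rightarrow> 'k) set)"
    by (intro subspaceI) (auto intro: zero_in_mixed_space mixed_space_add mixed_space_smult)
  then show ?thesis
    unfolding banach_space_def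
    by (auto simp: vector_space_smult mixed_norm_nonneg mixed_norm_eq_0_iff mixed_space_add
        mixed_norm_smult intro!: mixed_space_complete)
qed

section \<open>The basis\<close>

lemma restrict_seq_mem:
  assumes "f \<in> mixed_space"
  shows "restrict_seq A f \<in> mixed_space"
  using assms by (rule mixed_space_dominated) (simp add: restrict_seq_def)

lemma sum_smult_unit_seq:
  "finite A \<Longrightarrow> (\<Sum>n\<in>A. smult_seq (a n) (unit_seq n)) = restrict_seq A a"
  by (induction A rule: finite_induct)
    (auto simp: fun_eq_iff restrict_seq_def smult_seq_def unit_seq_def)

lemma initial_norm_le_sum: "initial_norm N f \<le> (\<Sum>n<N. norm (f n))"
proof -
  have "L2_set (\<lambda>n. if even n then norm (f n) else 0) {..<N} \<le>
      (\<Sum>n<N. if even n then norm (f n) else 0)"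
    by (rule L2_set_le_sum) auto
  then have "initial_norm N f \<le>
      (\<Sum>n<N. (if odd n then norm (f n) else 0) + (if even n then norm (f n) else 0))"
    unfolding initial_norm_def sum.distrib by simp
  also have "\<dots> = (\<Sum>n<N. norm (f n))"
    by (intro sum.cong) auto
  finally show ?thesis .
qed

lemma restrict_seq_finite_mem:
  assumes "finite A"
  shows "restrict_seq A f \<in> mixed_space"
proof (rule mixed_spaceI)
  fix N
  have "initial_norm N (restrict_seq A f) \<le> (\<Sum>n<N. norm (restrict_seq A f n))"
    by (rule initial_norm_le_sum)
  also have "\<dots> = (\<Sum>n\<in>{..<N} \<inter> A. norm (f n))"
    unfolding sum.inter_restrict[OF finite_lessThan] by (intro sum.cong) (auto simp: restrict_seq_def)
  also have "\<dots> \<le> (\<Sum>n\<in>A. norm (f n))"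
    using assms by (intro sum_mono2) auto
  finally show "initial_norm N (restrict_seq A f) \<le> (\<Sum>n\<in>A. norm (f n))" .
qed

text \<open>Applied twice below: to the moduli at odd indices and to the squared moduli at even
  indices.\<close>

lemma sum_tail_le_suminf:
  fixes a :: "nat \<Rightarrow> real"
  assumes "summable a" "\<And>n. 0 \<le> a n"
  shows "(\<Sum>n<M. if n < N then 0 else a n) \<le> suminf a - (\<Sum>n<N. a n)"
proof -
  have "(\<Sum>n<M. if n < N then 0 else a n) = (\<Sum>n\<in>{..<M} - {..<N}. a n)"
    by (intro sum.mono_neutral_cong_right) auto
  then have "(\<Sum>n<M. if n < N then 0 else a n) + (\<Sum>n<N. a n) = sum a (({..<M} - {..<N}) \<union> {..<N})"
    by (subst sum.union_disjoint) auto
  also have "\<dots> \<le> suminf a"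
    using assms by (intro sum_le_suminf) auto
  finally show ?thesis
    by simp
qed

text \<open>Bounded truncated norms make the \<ell>_1 series and the series of squares both
  converge. The norm of the tail is at most the first remainder plus the square root of the
  second.\<close>

lemma mixed_norm_tail:
  assumes "f \<in> mixed_space"
  shows "(\<lambda>N. mixed_norm (f - restrict_seq {..<N} f)) \<longlonglongrightarrow> 0"
proof -
  define a where "a n = (if odd n then norm (f n) else 0)" for n
  define b where "b n = (if even n then norm (f n) else 0)\<^sup>2" for n
  have nonneg: "0 \<le> a n" "0 \<le> b n" for n
    by (auto simp: a_def b_def)
  have initial: "initial_norm N f = (\<Sum>n<N. a n) + sqrt (\<Sum>n<N. b n)" for N
    by (simp add: initial_norm_def L2_set_def a_def b_def)
  note bound = initial_norm_le_mixed_norm[OF assms, unfolded initial]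
  have a: "summable a"
  proof (rule summableI_nonneg_bounded)
    show "(\<Sum>n<N. a n) \<le> mixed_norm f" for N
      using bound[of N] real_sqrt_ge_zero[OF sum_nonneg[of "{..<N}" b, OF nonneg(2)]] by linarith
  qed (rule nonneg)
  have b: "summable b"
  proof (rule summableI_nonneg_bounded)
    show "(\<Sum>n<N. b n) \<le> (mixed_norm f)\<^sup>2" for N
    proof (rule sqrt_le_D)
      show "sqrt (\<Sum>n<N. b n) \<le> mixed_norm f"
        using bound[of N] sum_nonneg[of "{..<N}" a, OF nonneg(1)] by linarith
    qed
  qed (rule nonneg)
  have upper: "mixed_norm (f - restrict_seq {..<N} f) \<le>
      (suminf a - (\<Sum>n<N. a n)) + sqrt (suminf b - (\<Sum>n<N. b n))" for N
  proof (intro mixed_norm_le)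
    fix M
    have odd: "(\<Sum>n<M. if odd n then norm ((f - restrict_seq {..<N} f) n) else 0) =
        (\<Sum>n<M. if n < N then 0 else a n)"
      by (intro sum.cong) (auto simp: restrict_seq_def a_def)
    have even: "L2_set (\<lambda>n. if even n then norm ((f - restrict_seq {..<N} f) n) else 0) {..<M} =
        sqrt (\<Sum>n<M. if n < N then 0 else b n)"
      unfolding L2_set_def by (intro arg_cong[where f = sqrt] sum.cong)
        (auto simp: restrict_seq_def b_def)
    show "initial_norm M (f - restrict_seq {..<N} f) \<le>
        (suminf a - (\<Sum>n<N. a n)) + sqrt (suminf b - (\<Sum>n<N. b n))"
      unfolding initial_norm_def odd even
      by (rule add_mono[OF sum_tail_le_suminf[OF a nonneg(1)]
            real_sqrt_le_mono[OF sum_tail_le_suminf[OF b nonneg(2)]]])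
  qed
  have lower: "0 \<le> mixed_norm (f - restrict_seq {..<N} f)" for N
    using assms by (intro mixed_norm_nonneg mixed_space_diff restrict_seq_mem)
  have lim: "(\<lambda>N. (suminf a - (\<Sum>n<N. a n)) + sqrt (suminf b - (\<Sum>n<N. b n))) \<longlonglongrightarrow> 0"
    using tendsto_add[OF tendsto_diff[OF tendsto_const[of "suminf a"] summable_LIMSEQ[OF a]]
        tendsto_real_sqrt[OF tendsto_diff[OF tendsto_const[of "suminf b"] summable_LIMSEQ[OF b]]]]
    by simp
  show ?thesis
    by (rule tendsto_sandwich[OF always_eventually[OF allI[OF lower]]
          always_eventually[OF allI[OF upper]] tendsto_const lim])
qed

text \<open>Stated as an equality of predicates so that both the unique existence in
  \<open>schauder_basis\<close> and the description operator in \<open>coord\<close> simplify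
  away.\<close>

lemma basis_expansion_unit_seq:
  assumes "x \<in> mixed_space"
  shows "basis_expansion smult_seq mixed_norm unit_seq x = (\<lambda>a. a = x)"
proof (rule ext, rule iffI)
  fix a
  assume "basis_expansion smult_seq mixed_norm unit_seq x a"
  then have lim: "(\<lambda>N. mixed_norm (x - restrict_seq {..<N} a)) \<longlonglongrightarrow> 0"
    by (simp add: basis_expansion_def sum_smult_unit_seq)
  have "norm (x k - a k) = 0" for k
  proof -
    \<comment> \<open>From \<open>N = Suc k\<close> on, truncation leaves coordinate
      \<open>k\<close> of \<open>a\<close> unchanged, so the left side is constant while the right
      side tends to 0.\<close>
    have "norm (x k - a k) \<le> mixed_norm (x - restrict_seq {..<N} a)" if "Suc k \<le> N" for N
    proof -
      have "x - restrict_seq {..<N} a \<in> mixed_space"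
        by (intro mixed_space_diff assms restrict_seq_finite_mem finite_lessThan)
      from norm_le_mixed_norm[OF this, of k] show ?thesis
        using that by (simp add: restrict_seq_def)
    qed
    then have "norm (x k - a k) \<le> 0"
      by (intro LIMSEQ_le_const[OF lim]) blast
    then show ?thesis
      by simp
  qed
  then show "a = x"
    by (auto simp: fun_eq_iff)
next
  fix a assume "a = x"
  then show "basis_expansion smult_seq mixed_norm unit_seq x a"
    using mixed_norm_tail[OF assms] by (simp add: basis_expansion_def sum_smult_unit_seq)
qed

lemma unit_seq_eq_restrict: "unit_seq n = restrict_seq {n} (\<lambda>_. 1)"
  by (auto simp: unit_seq_def restrict_seq_def)

lemma schauder_basis_unit_seq: "schauder_basis smult_seq mixed_space mixed_norm unit_seq"
  unfolding schauder_basis_def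
  by (simp add: basis_expansion_unit_seq unit_seq_eq_restrict restrict_seq_finite_mem)

lemma coord_unit_seq: "x \<in> mixed_space \<Longrightarrow> coord smult_seq mixed_norm unit_seq n x = x n"
  by (simp add: coord_def basis_expansion_unit_seq)

lemma partial_proj_unit_seq:
  "x \<in> mixed_space \<Longrightarrow> finite A \<Longrightarrow>
    partial_proj smult_seq mixed_norm unit_seq A x = restrict_seq A x"
  by (simp add: partial_proj_def coord_unit_seq sum_smult_unit_seq)

section \<open>Norms of indicator sequences\<close>

definition mixed_card :: "nat set \<Rightarrow> real"
  where "mixed_card A = card {n \<in> A. odd n} + sqrt (card {n \<in> A. even n})"

lemma mixed_norm_indicator:
  assumes "finite A"
  shows "mixed_norm (restrict_seq A (\<lambda>_. 1)) = mixed_card A"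
proof (rule antisym)
  have initial: "initial_norm N (restrict_seq A (\<lambda>_. 1 :: 'a)) = mixed_card (A \<inter> {..<N})" for N
  proof -
    have "(\<Sum>n<N. if odd n then norm (restrict_seq A (\<lambda>_. 1 :: 'a) n) else 0) =
        (\<Sum>n\<in>{n \<in> A \<inter> {..<N}. odd n}. 1)"
      by (intro sum.mono_neutral_cong_right) (auto simp: restrict_seq_def)
    moreover have "(\<Sum>n<N. (if even n then norm (restrict_seq A (\<lambda>_. 1 :: 'a) n) else 0)\<^sup>2) =
        (\<Sum>n\<in>{n \<in> A \<inter> {..<N}. even n}. 1)"
      by (intro sum.mono_neutral_cong_right) (auto simp: restrict_seq_def)
    ultimately show ?thesis
      by (simp add: initial_norm_def L2_set_def mixed_card_def)
  qed
  have "mixed_card (A \<inter> {..<N}) \<le> mixed_card A" for N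
    unfolding mixed_card_def using assms
    by (intro add_mono real_sqrt_le_mono of_nat_mono card_mono) auto
  then show "mixed_norm (restrict_seq A (\<lambda>_. 1 :: 'a)) \<le> mixed_card A"
    by (intro mixed_norm_le) (simp add: initial)
  obtain N where "A \<subseteq> {..<N}"
    using assms finite_nat_iff_bounded by blast
  then have "mixed_card A = initial_norm N (restrict_seq A (\<lambda>_. 1 :: 'a))"
    by (simp add: initial Int_absorb2)
  also have "\<dots> \<le> mixed_norm (restrict_seq A (\<lambda>_. 1 :: 'a))"
    using assms by (intro initial_norm_le_mixed_norm restrict_seq_finite_mem)
  finally show "mixed_card A \<le> mixed_norm (restrict_seq A (\<lambda>_. 1 :: 'a))" .
qed

lemma mixed_card_odd:
  assumes "\<And>n. n \<in> A \<Longrightarrow> odd n"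
  shows "mixed_card A = card A"
proof -
  have eq: "{n \<in> A. odd n} = A" "{n \<in> A. even n} = {}"
    using assms by auto
  show ?thesis
    unfolding mixed_card_def eq by simp
qed

lemma mixed_card_even:
  assumes "\<And>n. n \<in> A \<Longrightarrow> even n"
  shows "mixed_card A = sqrt (card A)"
proof -
  have eq: "{n \<in> A. odd n} = {}" "{n \<in> A. even n} = A"
    using assms by auto
  show ?thesis
    unfolding mixed_card_def eq by simp
qed

lemma mixed_card_singleton: "mixed_card {n} = 1"
  using mixed_card_odd[of "{n}"] mixed_card_even[of "{n}"] by (cases "odd n") auto

lemma semi_normalized_unit_seq: "semi_normalized mixed_norm unit_seq"
  unfolding semi_normalized_def unit_seq_eq_restrict
  by (rule exI[of _ 1], rule conjI, simp, rule exI[of _ 1])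
    (simp add: mixed_norm_indicator mixed_card_singleton)

section \<open>The structured weight\<close>

text \<open>Infinite sets need their own case, since \<open>card\<close> is 0 on them and
  \<open>mixed_card\<close> would no longer measure their size.\<close>

definition mixed_weight :: "nat set \<Rightarrow> ennreal"
  where "mixed_weight A = (if finite A then ennreal (mixed_card A) else \<infinity>)"

lemma mixed_card_nonneg: "0 \<le> mixed_card A"
  by (simp add: mixed_card_def)

lemma card_split_parity:
  assumes "finite A"
  shows "card A = card {n \<in> A. odd n} + card {n \<in> A. even n}"
proof -
  have "{n \<in> A. odd n} \<union> {n \<in> A. even n} = A"
    by auto
  moreover have "card ({n \<in> A. odd n} \<union> {n \<in> A. even n}) =
      card {n \<in> A. odd n} + card {n \<in> A. even n}"
    by (rule card_Un_disjoint) (use assms in auto)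
  ultimately show ?thesis
    by (simp only:)
qed

text \<open>The number of odd elements is 0 or at least 1, hence at least its own square root;
  subadditivity of the square root finishes. The bound yields positivity, growth and the pair
  condition for the weight.\<close>

lemma sqrt_card_le_mixed_card:
  assumes "finite A"
  shows "sqrt (card A) \<le> mixed_card A"
proof -
  define p q where "p = real (card {n \<in> A. odd n})" and "q = real (card {n \<in> A. even n})"
  have "sqrt p \<le> p"
  proof (cases "p = 0")
    case False
    then have "1 \<le> p"
      unfolding p_def by simp
    then have "p \<le> p\<^sup>2"
      by (rule self_le_power) simp
    with \<open>1 \<le> p\<close> show ?thesis
      by (intro real_le_lsqrt) auto
  qed simp
  have "sqrt (card A) = sqrt (p + q)"
    using card_split_parity[OF assms] by (simp add: p_def q_def)
  also have "\<dots> \<le> sqrt p + sqrt q"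
    by (rule sqrt_add_le_add_sqrt) (simp_all add: p_def q_def)
  also have "\<dots> \<le> p + sqrt q"
    using \<open>sqrt p \<le> p\<close> by simp
  finally show ?thesis
    by (simp add: mixed_card_def p_def q_def)
qed

lemma infsum_mixed_weight_singletons:
  "(\<Sum>\<^sub>\<infinity>n\<in>A. mixed_weight {n}) = (if finite A then of_nat (card A) else \<infinity>)"
proof (cases "finite A")
  case True
  then show ?thesis
    by (simp add: mixed_weight_def mixed_card_singleton)
next
  case False
  then show ?thesis
    by (simp add: mixed_weight_def mixed_card_singleton
        infsum_superconst_infinite_ennreal[where b = 1])
qed

lemma mixed_card_pair:
  assumes "N \<noteq> n"
  shows "sqrt 2 \<le> mixed_card {N, n}"
  using sqrt_card_le_mixed_card[of "{N, n}"] assms by simp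

lemma structured_weight_mixed: "structured_weight mixed_weight"
  unfolding structured_weight_def
proof (intro conjI allI impI)
  show "mixed_weight {} = 0"
    by (simp add: mixed_weight_def mixed_card_def)
  show "mixed_weight A < \<infinity>" if "finite A" for A
    using that by (simp add: mixed_weight_def)
  show "0 < mixed_weight A" if "A \<noteq> {}" for A
  proof (cases "finite A")
    case True
    then have "0 < sqrt (card A)"
      using that by (simp add: card_gt_0_iff)
    then show ?thesis
      using sqrt_card_le_mixed_card[OF True] by (simp add: mixed_weight_def True del: real_sqrt_gt_0_iff)
  qed (simp add: mixed_weight_def)
  fix \<eta> :: real assume "0 < \<eta>"
  \<comment> \<open>Every singleton has weight 1, so a total below 1 leaves only the empty set, and
    \<theta> = 1 serves every \<eta>.\<close>
  have "mixed_weight A < ennreal \<eta>" if "(\<Sum>\<^sub>\<infinity>n\<in>A. mixed_weight {n}) < ennreal 1" for A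
  proof -
    have "finite A" "card A < 1"
      using that unfolding infsum_mixed_weight_singletons
      by (auto split: if_splits simp: ennreal_of_nat_eq_real_of_nat)
    then show ?thesis
      using \<open>0 < \<eta>\<close> by (simp add: mixed_weight_def mixed_card_def)
  qed
  then show "\<exists>\<theta>::real. 0 < \<theta> \<and>
      (\<forall>A. (\<Sum>\<^sub>\<infinity>n\<in>A. mixed_weight {n}) < ennreal \<theta> \<longrightarrow> mixed_weight A < ennreal \<eta>)"
    using zero_less_one by blast
next
  fix M :: real assume "0 < M"
  \<comment> \<open>The total of the singleton weights is the cardinality, whose square root bounds
    the weight from below; this explains the choice \<open>K = M\<^sup>2\<close>.\<close>
  have "ennreal M < mixed_weight A" if "ennreal (M\<^sup>2) < (\<Sum>\<^sub>\<infinity>n\<in>A. mixed_weight {n})" for A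
  proof (cases "finite A")
    case True
    then have "M\<^sup>2 < real (card A)"
      using that unfolding infsum_mixed_weight_singletons
      by (simp add: ennreal_of_nat_eq_real_of_nat ennreal_less_iff)
    then have "M < sqrt (card A)"
      by (rule real_less_rsqrt)
    then show ?thesis
      using sqrt_card_le_mixed_card[OF True] \<open>0 < M\<close>
      by (simp add: mixed_weight_def True ennreal_less_iff)
  qed (simp add: mixed_weight_def)
  then show "\<exists>K::real. 0 < K \<and>
      (\<forall>A. ennreal K < (\<Sum>\<^sub>\<infinity>n\<in>A. mixed_weight {n}) \<longrightarrow> ennreal M < mixed_weight A)"
    using \<open>0 < M\<close> by (intro exI[of _ "M\<^sup>2"]) auto
next
  fix N0 :: nat
  \<comment> \<open>A pair weighs at least \<open>sqrt 2\<close> and a singleton 1, so 1/4 is a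
    uniform gap. Every index qualifies, and \<open>N0\<close> itself is taken as
    \<open>N\<close>.\<close>
  have "ennreal (1 / 4) < mixed_weight {N0, n} - mixed_weight {n}" if "n \<noteq> N0" for n
  proof -
    have "5 / 4 < sqrt 2"
      by (rule real_less_rsqrt) (simp add: power2_eq_square)
    then show ?thesis
      using mixed_card_pair[of N0 n] that
      by (simp add: mixed_weight_def mixed_card_singleton ennreal_minus ennreal_less_iff
          flip: ennreal_1)
  qed
  then show "\<exists>N\<ge>N0. \<exists>\<epsilon>::real. 0 < \<epsilon> \<and>
      (\<forall>n. n \<noteq> N \<longrightarrow> ennreal \<epsilon> < mixed_weight {N, n} - mixed_weight {n})"
    by (intro exI[of _ N0] conjI exI[of _ "1 / 4"]) auto
qed

section \<open>Greediness\<close>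

text \<open>A constant \<open>t\<close> separates the moduli on \<open>E\<close> from those on
  \<open>F\<close>, so both restrictions are compared with \<open>t\<close> times an indicator,
  whose norms are ordered by \<open>mixed_card\<close>.\<close>

lemma mixed_norm_restrict_le:
  fixes x :: "nat \<Rightarrow> 'k::{real_normed_field, banach}"
  assumes x: "x \<in> mixed_space" and fin: "finite E" "finite F"
    and le: "\<And>i j. i \<in> F \<Longrightarrow> j \<in> E \<Longrightarrow> norm (x j) \<le> norm (x i)"
    and card: "mixed_card E \<le> mixed_card F"
  shows "mixed_norm (restrict_seq E x) \<le> mixed_norm (restrict_seq F x)"
proof (cases "E = {}")
  case True
  then have "restrict_seq E x = 0"
    by (auto simp: restrict_seq_def)
  then show ?thesis
    using mixed_norm_nonneg[OF restrict_seq_mem[OF x]]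
      mixed_norm_eq_0_iff[OF zero_in_mixed_space, where 'a = 'k] by simp
next
  case False
  \<comment> \<open>The empty case was split off because the maximum needs a nonempty set.\<close>
  define t where "t = Max ((\<lambda>j. norm (x j)) ` E)"
  have tE: "norm (x j) \<le> t" if "j \<in> E" for j
    using that fin by (simp add: t_def)
  have tF: "t \<le> norm (x i)" if "i \<in> F" for i
    unfolding t_def using that fin False by (intro Max.boundedI) (auto intro: le)
  obtain j where "j \<in> E"
    using False by blast
  then have t: "0 \<le> t"
    using tE[of j] norm_ge_zero[of "x j"] by linarith
  have indicator: "mixed_norm (smult_seq (of_real t :: 'k) (restrict_seq B (\<lambda>_. 1))) = t * mixed_card B"
    if "finite B" for B
    using that t by (simp add: mixed_norm_smult restrict_seq_finite_mem mixed_norm_indicator)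
  have "mixed_norm (restrict_seq E x) \<le> mixed_norm (smult_seq (of_real t :: 'k) (restrict_seq E (\<lambda>_. 1)))"
    using t tE
    by (intro mixed_space_dominated(2)[OF mixed_space_smult[OF restrict_seq_finite_mem[OF fin(1)]]])
      (simp add: smult_seq_def restrict_seq_def)
  also have "\<dots> \<le> t * mixed_card F"
    using fin t card by (simp add: indicator mult_left_mono)
  also have "\<dots> = mixed_norm (smult_seq (of_real t :: 'k) (restrict_seq F (\<lambda>_. 1)))"
    using fin by (simp add: indicator)
  also have "\<dots> \<le> mixed_norm (restrict_seq F x)"
    using t tF
    by (intro mixed_space_dominated(2)[OF restrict_seq_mem[OF x]])
      (simp add: smult_seq_def restrict_seq_def)
  finally show ?thesis .
qed

text \<open>The constant 2 comes from splitting the greedy remainder into its parts outside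
  \<open>A \<union> \<Lambda>\<close> and on \<open>A - \<Lambda>\<close>; each is at most the error
  of the competing approximant supported on \<open>A\<close>.\<close>

lemma omega_greedy_mixed:
  "omega_greedy smult_seq (mixed_space :: (nat \<Rightarrow> 'k::{real_normed_field, banach}) set) mixed_norm
    unit_seq mixed_weight"
  unfolding omega_greedy_def
proof (intro exI[of _ 2] conjI ballI allI impI)
  fix x :: "nat \<Rightarrow> 'k" and m \<Lambda>
  assume x: "x \<in> mixed_space" and "greedy_set smult_seq mixed_norm unit_seq x m \<Lambda>"
  then have fin: "finite \<Lambda>" and greedy: "\<And>i j. i \<in> \<Lambda> \<Longrightarrow> j \<notin> \<Lambda> \<Longrightarrow> norm (x j) \<le> norm (x i)"
    by (auto simp: greedy_set_def coord_unit_seq)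
  let ?P = "x - restrict_seq \<Lambda> x"
  have "mixed_norm ?P / 2 \<le> sigma_omega smult_seq mixed_norm unit_seq mixed_weight \<Lambda> x"
    unfolding sigma_omega_def
  proof (rule cInf_greatest, goal_cases)
    case 1
    \<comment> \<open>The empty set is an admissible competitor, so the infimum is over a nonempty
      set.\<close>
    show ?case
      by (auto intro!: exI[of _ "{}"] simp: mixed_weight_def mixed_card_def)
  next
    case (2 r)
    then obtain A a where r: "r = mixed_norm (x - (\<Sum>n\<in>A. smult_seq (a n) (unit_seq n)))"
      and A: "finite A" "mixed_weight (A - \<Lambda>) \<le> mixed_weight (\<Lambda> - A)"
      by auto
    let ?y = "x - restrict_seq A a"
    have r: "r = mixed_norm ?y"
      using r A by (simp add: sum_smult_unit_seq)
    have y: "?y \<in> mixed_space"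
      using x A by (intro mixed_space_diff restrict_seq_finite_mem)
    have "mixed_card (A - \<Lambda>) \<le> mixed_card (\<Lambda> - A)"
      using A fin by (simp add: mixed_weight_def mixed_card_nonneg)
    then have "mixed_norm (restrict_seq (A - \<Lambda>) x) \<le> mixed_norm (restrict_seq (\<Lambda> - A) x)"
      using x A fin greedy by (intro mixed_norm_restrict_le) auto
    \<comment> \<open>Off \<open>A\<close> the approximant vanishes, so \<open>?y\<close> agrees
      with \<open>x\<close> there whatever the coefficients \<open>a\<close> are.\<close>
    also have "\<dots> \<le> r"
      unfolding r by (rule mixed_space_dominated(2)[OF y]) (simp add: restrict_seq_def)
    finally have "mixed_norm (restrict_seq (A - \<Lambda>) x) \<le> r" .
    moreover have "mixed_norm (restrict_seq (- (A \<union> \<Lambda>)) x) \<le> r"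
      unfolding r by (rule mixed_space_dominated(2)[OF y]) (simp add: restrict_seq_def)
    moreover have "?P = restrict_seq (- (A \<union> \<Lambda>)) x + restrict_seq (A - \<Lambda>) x"
      by (auto simp: restrict_seq_def)
    ultimately show ?case
      using mixed_space_add(2)[OF restrict_seq_mem[OF x] restrict_seq_mem[OF x],
          of "- (A \<union> \<Lambda>)" "A - \<Lambda>"] by simp
  qed
  then show "mixed_norm (x - partial_proj smult_seq mixed_norm unit_seq \<Lambda> x) \<le>
      2 * sigma_omega smult_seq mixed_norm unit_seq mixed_weight \<Lambda> x"
    using x fin by (simp add: partial_proj_unit_seq)
qed simp

text \<open>Test the inequality on the indicator of \<open>A \<union> B\<close>. All nonzero
  coefficients are equal, so \<open>B\<close> is a greedy set, of positive order since it is
  nonempty. By the weight comparison \<open>A\<close> is an admissible competitor, and its remainder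
  is the indicator of \<open>B\<close>.\<close>

lemma almost_greedy_imp_democratic:
  assumes "almost_greedy smult_seq (mixed_space :: (nat \<Rightarrow> 'k::{real_normed_field, banach}) set)
    mixed_norm unit_seq s"
  obtains C where "1 \<le> C"
    "\<And>A B. \<lbrakk>finite A; finite B; A \<inter> B = {}; B \<noteq> {}; sum s A \<le> sum s B\<rbrakk> \<Longrightarrow>
      mixed_card A \<le> C * mixed_card B"
proof -
  obtain C where C: "1 \<le> C" and greedy: "\<And>(x :: nat \<Rightarrow> 'k) m \<Lambda>.
      \<lbrakk>x \<in> mixed_space; 1 \<le> m; greedy_set smult_seq mixed_norm unit_seq x m \<Lambda>\<rbrakk> \<Longrightarrow>
      mixed_norm (x - partial_proj smult_seq mixed_norm unit_seq \<Lambda> x) \<le>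
      C * sigma_tilde smult_seq mixed_norm unit_seq s (sum s \<Lambda>) x"
    using assms unfolding almost_greedy_def by blast
  have "mixed_card A \<le> C * mixed_card B"
    if fin: "finite A" "finite B" and disj: "A \<inter> B = {}" and ne: "B \<noteq> {}"
      and le: "sum s A \<le> sum s B" for A B
  proof -
    define x where "x = restrict_seq (A \<union> B) (\<lambda>_. 1 :: 'k)"
    have x: "x \<in> mixed_space"
      using fin by (simp add: x_def restrict_seq_finite_mem)
    have x_minus: "x - partial_proj smult_seq mixed_norm unit_seq A x = restrict_seq B (\<lambda>_. 1)"
        "x - partial_proj smult_seq mixed_norm unit_seq B x = restrict_seq A (\<lambda>_. 1)"
      unfolding partial_proj_unit_seq[OF x fin(1)] partial_proj_unit_seq[OF x fin(2)]
      using disj by (auto simp: x_def restrict_seq_def fun_eq_iff)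
    have "greedy_set smult_seq mixed_norm unit_seq x (card B) B"
      unfolding greedy_set_def using fin x by (auto simp: coord_unit_seq) (auto simp: x_def restrict_seq_def)
    moreover have "1 \<le> card B"
      using fin ne by (simp add: Suc_leI card_gt_0_iff)
    ultimately have "mixed_card A \<le> C * sigma_tilde smult_seq mixed_norm unit_seq s (sum s B) x"
      using greedy[of x "card B" B] x fin by (simp add: x_minus mixed_norm_indicator)
    also have "sigma_tilde smult_seq mixed_norm unit_seq s (sum s B) x \<le> mixed_card B"
      unfolding sigma_tilde_def
    proof (rule cInf_lower)
      show "mixed_card B \<in> {mixed_norm (x - partial_proj smult_seq mixed_norm unit_seq A x) |A.
          finite A \<and> sum s A \<le> sum s B}"
        using fin le x_minus(1) mixed_norm_indicator[OF fin(2), where 'a = 'k]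
        by (auto intro!: exI[of _ A])
      show "bdd_below {mixed_norm (x - partial_proj smult_seq mixed_norm unit_seq A x) |A.
          finite A \<and> sum s A \<le> sum s B}"
        using x by (intro bdd_belowI[of _ 0])
          (auto simp: partial_proj_unit_seq intro!: mixed_norm_nonneg mixed_space_diff restrict_seq_mem)
    qed
    finally show ?thesis
      using C by simp
  qed
  then show ?thesis
    using that C by blast
qed

text \<open>Additivity gives \<open>k\<^sup>2\<close> disjoint blocks of even indices a weight
  growing quadratically in \<open>k\<close>. Yet they weigh less than a set of odd indices of size
  linear in \<open>k\<close>, whose weight is at most linear.\<close>

lemma not_additively_democratic:
  fixes s :: "nat \<Rightarrow> real"
  assumes pos: "\<And>n. 0 < s n" and C: "1 \<le> C"
    and dem: "\<And>A B. \<lbrakk>finite A; finite B; A \<inter> B = {}; B \<noteq> {}; sum s A \<le> sum s B\<rbrakk> \<Longrightarrow>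
      mixed_card A \<le> C * mixed_card B"
  shows False
proof -
  obtain K :: nat where K: "C < real K"
    using reals_Archimedean2 by blast
  then have "0 < K"
    using C by (cases K) auto
  \<comment> \<open>\<open>K\<^sup>2\<close> even indices have norm \<open>K\<close>, which exceeds
    \<open>C\<close> times the norm 1 of a singleton.\<close>
  have even_gt_odd: "s a < sum s B"
    if a: "odd a" and B: "finite B" "\<And>n. n \<in> B \<Longrightarrow> even n" "card B = K\<^sup>2" for a B
  proof (rule ccontr)
    assume "\<not> s a < sum s B"
    moreover have "a \<notin> B"
      using a B(2) by blast
    ultimately have "mixed_card B \<le> C * mixed_card {a}"
      using B(1) by (intro dem) auto
    then show False
      using K by (simp add: mixed_card_even[OF B(2)] B(3) mixed_card_singleton)
  qed
  \<comment> \<open>Here the norms are \<open>K * k\<close> for the odd set and \<open>k\<close> for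
    the even one, again violating the bound by \<open>C\<close>.\<close>
  have odd_gt_even: "sum s B < sum s A"
    if A: "finite A" "\<And>n. n \<in> A \<Longrightarrow> odd n" "card A = K * k"
      and B: "finite B" "\<And>n. n \<in> B \<Longrightarrow> even n" "card B = k\<^sup>2" and "0 < k" for A B k
  proof (rule ccontr)
    assume "\<not> sum s B < sum s A"
    moreover have "A \<inter> B = {}"
      using A(2) B(2) by blast
    moreover have "B \<noteq> {}"
      using B(3) \<open>0 < k\<close> by auto
    ultimately have "mixed_card A \<le> C * mixed_card B"
      using A(1) B(1) by (intro dem) auto
    then have "real K * real k \<le> C * real k"
      by (simp add: mixed_card_odd[OF A(2)] mixed_card_even[OF B(2)] A(3) B(3))
    then show False
      using K \<open>0 < k\<close> by simp
  qed
  \<comment> \<open>Consecutive runs of \<open>K\<^sup>2\<close> even numbers, each heavier than any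
    single odd index. Halving and dividing by \<open>K\<^sup>2\<close> recovers the block number,
    whence disjointness.\<close>
  define block where "block i = (\<lambda>j. 2 * (i * K\<^sup>2 + j)) ` {..<K\<^sup>2}" for i :: nat
  have card_block: "card (block i) = K\<^sup>2" for i
    unfolding block_def by (subst card_image) (auto simp: inj_on_def)
  have finite_block: "finite (block i)" and even_block: "\<And>n. n \<in> block i \<Longrightarrow> even n" for i
    by (auto simp: block_def)
  have bound: "s a < sum s (block i)" if "odd a" for a i
    using that finite_block even_block card_block by (rule even_gt_odd)
  have "n div 2 div K\<^sup>2 = i" if "n \<in> block i" for n i
    using that \<open>0 < K\<close> by (auto simp: block_def div_mult_self3)
  then have disj: "block i \<inter> block j = {}" if "i \<noteq> j" for i j
    using that by blast
  \<comment> \<open>One fixed block bounds the weights of all odd indices.\<close>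
  define M where "M = sum s (block 0)"
  have ineq: "real k * s 1 < M * (real K)\<^sup>2" if "0 < k" for k :: nat
  proof -
    define A where "A = (\<lambda>j. 2 * j + 1) ` {..<K * (k * K)}"
    define B where "B = (\<Union>i<k\<^sup>2. block i)"
    have A: "finite A" "\<And>n. n \<in> A \<Longrightarrow> odd n"
      by (auto simp: A_def)
    have card_A: "card A = K * (k * K)"
      unfolding A_def by (subst card_image) (auto simp: inj_on_def)
    have B: "finite B" "\<And>n. n \<in> B \<Longrightarrow> even n"
      using finite_block even_block by (auto simp: B_def)
    have "card B = (\<Sum>i<k\<^sup>2. card (block i))"
      unfolding B_def by (rule card_UN_disjoint) (use disj finite_block in blast)+
    then have card_B: "card B = (k * K)\<^sup>2"
      by (simp add: card_block power_mult_distrib)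
    have "real (k\<^sup>2) * s 1 = (\<Sum>i<k\<^sup>2. s 1)"
      by simp
    also have "\<dots> \<le> (\<Sum>i<k\<^sup>2. sum s (block i))"
      by (intro sum_mono less_imp_le bound) simp
    also have "\<dots> = sum s B"
      unfolding B_def by (rule sum.UNION_disjoint[symmetric]) (use disj finite_block in blast)+
    \<comment> \<open>The comparison is used with parameter \<open>k * K\<close>: \<open>B\<close>
      has \<open>(k * K)\<^sup>2\<close> elements and \<open>A\<close> has
      \<open>K * (k * K)\<close>.\<close>
    also have "\<dots> < sum s A"
      using A card_A B card_B by (rule odd_gt_even[OF _ _ _ _ _ _ mult_pos_pos[OF \<open>0 < k\<close> \<open>0 < K\<close>]])
    also have "\<dots> \<le> real (card A) * M"
      unfolding M_def by (rule sum_bounded_above) (intro less_imp_le bound A(2))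
    finally have "real k * (real k * s 1) < real k * (M * (real K)\<^sup>2)"
      by (simp add: card_A power2_eq_square algebra_simps)
    then show ?thesis
      using that by simp
  qed
  obtain k :: nat where "M * (real K)\<^sup>2 / s 1 < real k"
    using reals_Archimedean2 by blast
  \<comment> \<open>The successor is taken because \<open>ineq\<close> asks for a positive
    \<open>k\<close>.\<close>
  then have "M * (real K)\<^sup>2 < real (Suc k) * s 1"
    using pos[of 1] by (simp add: field_simps)
  then show False
    using ineq[of "Suc k"] by simp
qed

lemma not_almost_greedy_mixed:
  assumes "\<And>n. 0 < s n"
  shows "\<not> almost_greedy smult_seq (mixed_space :: (nat \<Rightarrow> 'k::{real_normed_field, banach}) set)
    mixed_norm unit_seq s"
proof
  assume "almost_greedy smult_seq (mixed_space :: (nat \<Rightarrow> 'k) set) mixed_norm unit_seq s"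
  then obtain C where "1 \<le> C"
    "\<And>A B. \<lbrakk>finite A; finite B; A \<inter> B = {}; B \<noteq> {}; sum s A \<le> sum s B\<rbrakk> \<Longrightarrow>
      mixed_card A \<le> C * mixed_card B"
    using almost_greedy_imp_democratic by blast
  with assms show False
    by (rule not_additively_democratic)
qed

text \<open>Kept generic in the complete scalar field so that the real and complex cases are both
  instances.\<close>

lemma omega_greedy_not_almost_greedy:
  "\<exists>(smul :: 'k::{real_normed_field, banach} \<Rightarrow> (nat \<Rightarrow> 'k) \<Rightarrow> (nat \<Rightarrow> 'k)) V nrm e.
      banach_space smul V nrm \<and> schauder_basis smul V nrm e \<and> semi_normalized nrm e \<and>
      (\<exists>w. structured_weight w \<and> omega_greedy smul V nrm e w) \<and>
      (\<forall>s::nat \<Rightarrow> real. (\<forall>n. 0 < s n) \<longrightarrow> \<not> almost_greedy smul V nrm e s)"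
  by (rule exI[of _ smult_seq], rule exI[of _ mixed_space], rule exI[of _ mixed_norm],
      rule exI[of _ unit_seq], intro conjI exI[of _ mixed_weight] allI impI)
    (simp_all add: banach_space_mixed schauder_basis_unit_seq semi_normalized_unit_seq
      structured_weight_mixed omega_greedy_mixed not_almost_greedy_mixed)

theorem theorem3p4:
  "(\<exists>(smul :: real \<Rightarrow> (nat \<Rightarrow> real) \<Rightarrow> (nat \<Rightarrow> real)) V nrm e.
      banach_space smul V nrm \<and> schauder_basis smul V nrm e \<and> semi_normalized nrm e \<and>
      (\<exists>w. structured_weight w \<and> omega_greedy smul V nrm e w) \<and>
      (\<forall>s::nat \<Rightarrow> real. (\<forall>n. 0 < s n) \<longrightarrow> \<not> almost_greedy smul V nrm e s)) \<and>
   (\<exists>(smul :: complex \<Rightarrow> (nat \<Rightarrow> complex) \<Rightarrow> (nat \<Rightarrow> complex)) V nrm e.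
      banach_space smul V nrm \<and> schauder_basis smul V nrm e \<and> semi_normalized nrm e \<and>
      (\<exists>w. structured_weight w \<and> omega_greedy smul V nrm e w) \<and>
      (\<forall>s::nat \<Rightarrow> real. (\<forall>n. 0 < s n) \<longrightarrow> \<not> almost_greedy smul V nrm e s))"
  by (intro conjI omega_greedy_not_almost_greedy)

end
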